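(* Let $\mathbf{f}=\{f_0,\ldots,f_m\}\subset k[x_0,\ldots,x_n]$ be a set of forms of the same degree $d\ge 1$, with Newton complementary dual set $\widehat{\mathbf{f}}$. If $\mathbf{f}$ satisfies the canonical restrictions, then so does $\widehat{\mathbf{f}}$, and one has $\widehat{\widehat{\mathbf{f}}}=\mathbf{f}$.
   Context: $k$ is an infinite field. Canonical restrictions: an ordered set $\mathbf{f}=\{f_0,\ldots,f_m\}$ of forms of the same degree, not all zero, satisfies the canonical restrictions if $\gcd\{f_0,\ldots,f_m\}=1$ and every variable $x_i$ appears effectively in some $f_j$. Newton complementary dual: write each $f_j=\sum_{\ell=1}^{r_j}c_{j,\ell}\,\mathbf{x}^{a_{j,\ell}}$ as the sum of its nonzero terms. For $0\le i\le n$ let $\alpha_i$ be the maximum of the exponents of $x_i$ over all nonzero terms of all the forms $f_0,\ldots,f_m$, and $\underline{\alpha}=(\alpha_0,\ldots,\alpha_n)$. Then $\widehat{f_j}:=\sum_{\ell=1}^{r_j}c_{j,\ell}\,\mathbf{x}^{\underline{\alpha}-a_{j,\ell}}$ and $\widehat{\mathbf{f}}:=\{\widehat{f_0},\ldots,\widehat{f_m}\}$, a set of forms of degree $\alpha_0+\cdots+\alpha_n-d$. The set $\widehat{\widehat{\mathbf{f}}}$ is obtained by applying the same construction to $\widehat{\mathbf{f}}$. *)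

theory Defs
  imports "HOL-Library.Poly_Mapping"
begin

text \<open>
  A monomial is a finitely supported exponent function on variable indices, and a polynomial is a
  finitely supported coefficient function on monomials, with the convolution product of
  \<^theory>\<open>HOL-Library.Poly_Mapping\<close>.  In this type there are variables \<open>x\<^sub>i\<close> for all natural
  numbers \<open>i\<close>; the ring \<open>k[x\<^sub>0, \<dots>, x\<^sub>n]\<close> is the subset \<open>poly_ring n\<close>.
\<close>

type_synonym monom = "nat \<Rightarrow>\<^sub>0 nat"
type_synonym 'k mpoly = "monom \<Rightarrow>\<^sub>0 'k"

definition poly_ring :: "nat \<Rightarrow> 'k::comm_ring_1 mpoly set" where
  "poly_ring n = {p. \<forall>a \<in> Poly_Mapping.keys p. Poly_Mapping.keys a \<subseteq> {..n}}"

text \<open>The zero polynomial is a form of every degree.\<close>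

definition is_form :: "nat \<Rightarrow> nat \<Rightarrow> 'k::comm_ring_1 mpoly \<Rightarrow> bool" where
  "is_form n d p \<longleftrightarrow> p \<in> poly_ring n \<and>
     (\<forall>a \<in> Poly_Mapping.keys p. (\<Sum>i\<le>n. Poly_Mapping.lookup a i) = d)"

definition divides_in :: "nat \<Rightarrow> 'k::comm_ring_1 mpoly \<Rightarrow> 'k mpoly \<Rightarrow> bool" where
  "divides_in n g p \<longleftrightarrow> (\<exists>h \<in> poly_ring n. p = g * h)"

text \<open>
  Greatest common divisors are determined only up to units, so \<open>gcd F = 1\<close> is rendered as
  \<open>is_gcd_in n F 1\<close>.
\<close>

definition is_gcd_in :: "nat \<Rightarrow> 'k::comm_ring_1 mpoly set \<Rightarrow> 'k mpoly \<Rightarrow> bool" where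
  "is_gcd_in n F g \<longleftrightarrow> g \<in> poly_ring n \<and> (\<forall>p\<in>F. divides_in n g p) \<and>
     (\<forall>h \<in> poly_ring n. (\<forall>p\<in>F. divides_in n h p) \<longrightarrow> divides_in n h g)"

definition appears_in :: "nat \<Rightarrow> 'k::comm_ring_1 mpoly \<Rightarrow> bool" where
  "appears_in i p \<longleftrightarrow> (\<exists>a \<in> Poly_Mapping.keys p. Poly_Mapping.lookup a i > 0)"

text \<open>The ordered set \<open>{f\<^sub>0, \<dots>, f\<^sub>m}\<close> is represented by the list \<open>[f\<^sub>0, \<dots>, f\<^sub>m]\<close>.\<close>

definition canonical_restrictions :: "nat \<Rightarrow> 'k::comm_ring_1 mpoly list \<Rightarrow> bool" where
  "canonical_restrictions n fs \<longleftrightarrow>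
     (\<exists>d. \<forall>f \<in> set fs. is_form n d f) \<and>
     (\<exists>f \<in> set fs. f \<noteq> 0) \<and>
     is_gcd_in n (set fs) 1 \<and>
     (\<forall>i\<le>n. \<exists>f \<in> set fs. appears_in i f)"

text \<open>
  \<open>max_exponent fs i\<close> is \<open>\<alpha>\<^sub>i\<close>; the maximum is over a nonempty set as soon as some form is nonzero.
\<close>

definition max_exponent :: "'k::comm_ring_1 mpoly list \<Rightarrow> nat \<Rightarrow> nat" where
  "max_exponent fs i =
     Max (\<Union>f \<in> set fs. (\<lambda>a. Poly_Mapping.lookup a i) ` Poly_Mapping.keys f)"

definition max_exponents :: "nat \<Rightarrow> 'k::comm_ring_1 mpoly list \<Rightarrow> monom" where
  "max_exponents n fs = (\<Sum>i\<le>n. Poly_Mapping.single i (max_exponent fs i))"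

text \<open>
  Subtraction of exponent functions is pointwise and truncated, but every exponent vector occurring
  in \<open>fs\<close> is bounded by \<open>max_exponents n fs\<close> when \<open>set fs \<subseteq> poly_ring n\<close>.
\<close>

definition newton_dual :: "nat \<Rightarrow> 'k::comm_ring_1 mpoly list \<Rightarrow> 'k mpoly list" where
  "newton_dual n fs =
     map (\<lambda>f. \<Sum>a \<in> Poly_Mapping.keys f.
            Poly_Mapping.single (max_exponents n fs - a) (Poly_Mapping.lookup f a)) fs"

end

theory Submission
  imports Defs
begin

text \<open>
  Up to a monomial factor, \<open>f \<mapsto> x\<^sup>\<alpha> f(1/x\<^sub>0, \<dots>, 1/x\<^sub>n)\<close> is an involution that respects products,
  and the Newton complementary dual applies it to each form, for one common exponent \<open>\<alpha>\<close>
  (\<open>reflect\<close> below).  Since the \<open>f\<^sub>j\<close> have no common factor \<open>x\<^sub>i\<close>, some term of some \<open>f\<^sub>j\<close> is free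
  of \<open>x\<^sub>i\<close>; hence the dual forms again have maximal exponent \<open>\<alpha>\<^sub>i\<close> in \<open>x\<^sub>i\<close>.  So the second
  reflection is at the same \<open>\<alpha>\<close> and undoes the first, and every variable occurs in the dual.

  For the gcd, let \<open>h\<close> divide all dual forms.  Because the coefficients lie in a field, the degree
  in each variable is additive on products (\<open>keys_mult_exponent_ge\<close>), so the reflection of a product
  at \<open>\<alpha>\<close> is the product of the reflections of the factors at their own maximal exponents, times a
  monomial (\<open>reflect_divides\<close>).  Reflecting \<open>h\<close> therefore gives a common divisor of the \<open>f\<^sub>j\<close>, that
  is, a constant, and \<open>h\<close> itself is a single term.  No variable divides this term: some term of some
  \<open>f\<^sub>j\<close> attains the exponent \<open>\<alpha>\<^sub>i\<close>, and its dual is free of \<open>x\<^sub>i\<close>.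
\<close>

section \<open>Degrees in one variable\<close>

definition select_terms :: "monom set \<Rightarrow> 'k::comm_ring_1 mpoly \<Rightarrow> 'k mpoly" where
  "select_terms S p = (\<Sum>a \<in> Poly_Mapping.keys p \<inter> S. Poly_Mapping.single a (Poly_Mapping.lookup p a))"

lemma lookup_select_terms:
  "Poly_Mapping.lookup (select_terms S p) a = (if a \<in> S then Poly_Mapping.lookup p a else 0)"
  by (auto simp: select_terms_def lookup_sum lookup_single when_def in_keys_iff sum.delta)

lemma keys_select_terms: "Poly_Mapping.keys (select_terms S p) = Poly_Mapping.keys p \<inter> S"
  by (auto simp: in_keys_iff lookup_select_terms split: if_splits)

lemma select_terms_add_complement: "select_terms S p + select_terms (- S) p = p"
  by (rule poly_mapping_eqI) (auto simp: lookup_add lookup_select_terms)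

text \<open>
  The terms of top degree in \<open>x\<^sub>i\<close> of two polynomials have a nonzero product, and none of its
  terms can be cancelled by the remaining products, whose degrees in \<open>x\<^sub>i\<close> are smaller.
\<close>

lemma keys_mult_exponent_ge:
  fixes p q :: "'k::field mpoly"
  assumes "a \<in> Poly_Mapping.keys p" "b \<in> Poly_Mapping.keys q"
  shows "\<exists>c \<in> Poly_Mapping.keys (p * q).
           Poly_Mapping.lookup a i + Poly_Mapping.lookup b i \<le> Poly_Mapping.lookup c i"
proof -
  let ?e = "\<lambda>a::monom. Poly_Mapping.lookup a i"
  define A where "A = Max (?e ` Poly_Mapping.keys p)"
  define B where "B = Max (?e ` Poly_Mapping.keys q)"
  have A: "A \<in> ?e ` Poly_Mapping.keys p" "\<And>x. x \<in> Poly_Mapping.keys p \<Longrightarrow> ?e x \<le> A"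
    using assms unfolding A_def by (auto intro: Max_in simp del: Max_in)
  have B: "B \<in> ?e ` Poly_Mapping.keys q" "\<And>x. x \<in> Poly_Mapping.keys q \<Longrightarrow> ?e x \<le> B"
    using assms unfolding B_def by (auto intro: Max_in simp del: Max_in)
  define P where "P = {a. ?e a = A}"
  define Q where "Q = {a. ?e a = B}"
  let ?pt = "select_terms P p" and ?pr = "select_terms (- P) p"
  let ?qt = "select_terms Q q" and ?qr = "select_terms (- Q) q"
  have "Poly_Mapping.keys ?pt \<noteq> {}" "Poly_Mapping.keys ?qt \<noteq> {}"
    using A B by (auto simp: keys_select_terms P_def Q_def)
  then have "?pt * ?qt \<noteq> 0" by auto
  then obtain c where c: "c \<in> Poly_Mapping.keys (?pt * ?qt)"
    by (metis keys_eq_empty equals0I)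
  have ec: "?e c = A + B"
    using c keys_mult[of ?pt ?qt] by (auto simp: keys_select_terms P_def Q_def lookup_add)
  have n1: "c \<notin> Poly_Mapping.keys (?pt * ?qr)"
  proof
    assume "c \<in> Poly_Mapping.keys (?pt * ?qr)"
    then obtain x y where "x \<in> Poly_Mapping.keys ?pt" "y \<in> Poly_Mapping.keys ?qr" "c = x + y"
      using keys_mult[of ?pt ?qr] by blast
    with ec B(2)[of y] show False by (auto simp: keys_select_terms P_def Q_def lookup_add)
  qed
  have n2: "c \<notin> Poly_Mapping.keys (?pr * q)"
  proof
    assume "c \<in> Poly_Mapping.keys (?pr * q)"
    then obtain x y where "x \<in> Poly_Mapping.keys ?pr" "y \<in> Poly_Mapping.keys q" "c = x + y"
      using keys_mult[of ?pr q] by blast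
    with ec A(2)[of x] B(2)[of y] show False by (auto simp: keys_select_terms P_def lookup_add)
  qed
  have "p * q = ?pt * (?qt + ?qr) + ?pr * q"
    by (metis select_terms_add_complement distrib_right)
  then have "p * q = ?pt * ?qt + ?pt * ?qr + ?pr * q"
    by (simp add: distrib_left)
  then have "Poly_Mapping.lookup (p * q) c = Poly_Mapping.lookup (?pt * ?qt) c"
    using n1 n2 by (simp add: lookup_add in_keys_iff)
  with c have "c \<in> Poly_Mapping.keys (p * q)" by (simp add: in_keys_iff)
  moreover have "?e a + ?e b \<le> ?e c" using ec A(2)[OF assms(1)] B(2)[OF assms(2)] by simp
  ultimately show ?thesis by blast
qed

text \<open>A variable occurring in \<open>p\<close> would occur in the product.\<close>

lemma keys_factor_of_one:
  fixes p q :: "'k::field mpoly"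
  assumes "p * q = 1"
  shows "Poly_Mapping.keys p = {0}"
proof -
  have "p \<noteq> 0" "q \<noteq> 0" using assms by auto
  then obtain b where b: "b \<in> Poly_Mapping.keys q" by (metis keys_eq_empty equals0I)
  have "a = 0" if "a \<in> Poly_Mapping.keys p" for a
  proof (rule poly_mapping_eqI)
    fix i
    show "Poly_Mapping.lookup a i = Poly_Mapping.lookup 0 i"
      using keys_mult_exponent_ge[OF that b, of i] assms by (auto split: if_splits)
  qed
  with \<open>p \<noteq> 0\<close> show ?thesis by (metis keys_eq_empty subset_singletonD subsetI singletonI)
qed

section \<open>The polynomial ring in finitely many variables\<close>

lemma poly_ringD: "p \<in> poly_ring n \<Longrightarrow> a \<in> Poly_Mapping.keys p \<Longrightarrow> \<not> i \<le> n \<Longrightarrow> Poly_Mapping.lookup a i = 0"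
  by (force simp: poly_ring_def in_keys_iff)

lemma poly_ringI:
  "(\<And>a i. a \<in> Poly_Mapping.keys p \<Longrightarrow> \<not> i \<le> n \<Longrightarrow> Poly_Mapping.lookup a i = 0) \<Longrightarrow> p \<in> poly_ring n"
  by (force simp: poly_ring_def in_keys_iff)

lemma poly_ring_single: "(\<And>i. \<not> i \<le> n \<Longrightarrow> Poly_Mapping.lookup a i = 0) \<Longrightarrow> Poly_Mapping.single a c \<in> poly_ring n"
  by (rule poly_ringI) (auto split: if_splits)

lemma divides_in_zero: "divides_in n g 0"
proof -
  have "0 \<in> poly_ring n" by (simp add: poly_ring_def)
  then show ?thesis unfolding divides_in_def by (metis mult_zero_right)
qed

section \<open>Reflection of exponents\<close>

definition exponents_le :: "'k::comm_ring_1 mpoly \<Rightarrow> monom \<Rightarrow> bool" where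
  "exponents_le p \<alpha> \<longleftrightarrow>
     (\<forall>a \<in> Poly_Mapping.keys p. \<forall>i. Poly_Mapping.lookup a i \<le> Poly_Mapping.lookup \<alpha> i)"

text \<open>
  This is \<open>x\<^sup>\<alpha> p(1/x\<^sub>0, 1/x\<^sub>1, \<dots>)\<close> when \<open>exponents_le p \<alpha>\<close>; otherwise the truncated subtraction
  distorts some terms.
\<close>

definition reflect :: "monom \<Rightarrow> 'k::comm_ring_1 mpoly \<Rightarrow> 'k mpoly" where
  "reflect \<alpha> p = (\<Sum>a \<in> Poly_Mapping.keys p. Poly_Mapping.single (\<alpha> - a) (Poly_Mapping.lookup p a))"

lemma reflect_0 [simp]: "reflect \<alpha> 0 = 0"
  by (simp add: reflect_def)

lemma reflect_single [simp]: "reflect \<alpha> (Poly_Mapping.single a c) = Poly_Mapping.single (\<alpha> - a) c"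
  by (simp add: reflect_def)

text \<open>
  Additivity lets identities between reflections be checked on single terms, where they are
  identities between exponents.
\<close>

lemma reflect_add: "reflect \<alpha> (p + q) = reflect \<alpha> p + reflect \<alpha> q"
proof -
  let ?S = "Poly_Mapping.keys p \<union> Poly_Mapping.keys q"
  have *: "reflect \<alpha> r = (\<Sum>a \<in> ?S. Poly_Mapping.single (\<alpha> - a) (Poly_Mapping.lookup r a))"
    if "Poly_Mapping.keys r \<subseteq> ?S" for r
    unfolding reflect_def using that by (intro sum.mono_neutral_left) (auto simp: in_keys_iff)
  show ?thesis
    using Poly_Mapping.keys_add[of p q] by (simp add: * lookup_add single_add sum.distrib)
qed

lemma reflect_sum: "reflect \<alpha> (\<Sum>x \<in> S. g x) = (\<Sum>x \<in> S. reflect \<alpha> (g x))"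
  by (induction S rule: infinite_finite_induct) (auto simp: reflect_add)

lemma sum_of_terms: "(\<Sum>a \<in> Poly_Mapping.keys p. Poly_Mapping.single a (Poly_Mapping.lookup p a)) = p"
  by (rule poly_mapping_eqI) (auto simp: lookup_sum lookup_single when_def in_keys_iff sum.delta)

lemma reflect_reflect:
  assumes "exponents_le p \<alpha>"
  shows "reflect \<alpha> (reflect \<alpha> p) = p"
proof -
  have "\<alpha> - (\<alpha> - a) = a" if "a \<in> Poly_Mapping.keys p" for a
    using assms that by (intro poly_mapping_eqI) (auto simp: exponents_le_def lookup_minus)
  then have "reflect \<alpha> (reflect \<alpha> p)
      = (\<Sum>a \<in> Poly_Mapping.keys p. Poly_Mapping.single a (Poly_Mapping.lookup p a))"
    unfolding reflect_def[of \<alpha> p] by (simp add: reflect_sum)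
  then show ?thesis by (simp add: sum_of_terms)
qed

lemma keys_reflect_subset: "Poly_Mapping.keys (reflect \<alpha> p) \<subseteq> (\<lambda>a. \<alpha> - a) ` Poly_Mapping.keys p"
proof
  fix b assume "b \<in> Poly_Mapping.keys (reflect \<alpha> p)"
  then obtain a where "a \<in> Poly_Mapping.keys p"
      "b \<in> Poly_Mapping.keys (Poly_Mapping.single (\<alpha> - a) (Poly_Mapping.lookup p a))"
    using Poly_Mapping.keys_sum[of "\<lambda>a. Poly_Mapping.single (\<alpha> - a) (Poly_Mapping.lookup p a)"]
    unfolding reflect_def by blast
  then show "b \<in> (\<lambda>a. \<alpha> - a) ` Poly_Mapping.keys p" by (auto split: if_splits)
qed

lemma exponents_le_reflect: "exponents_le (reflect \<alpha> p) \<alpha>"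
  using keys_reflect_subset[of \<alpha> p] by (force simp: exponents_le_def lookup_minus)

lemma keys_reflect:
  assumes "exponents_le p \<alpha>"
  shows "Poly_Mapping.keys (reflect \<alpha> p) = (\<lambda>a. \<alpha> - a) ` Poly_Mapping.keys p"
proof
  show "(\<lambda>a. \<alpha> - a) ` Poly_Mapping.keys p \<subseteq> Poly_Mapping.keys (reflect \<alpha> p)"
  proof clarify
    fix a assume "a \<in> Poly_Mapping.keys p"
    then have "a \<in> Poly_Mapping.keys (reflect \<alpha> (reflect \<alpha> p))"
      using assms by (simp add: reflect_reflect)
    then obtain b where b: "b \<in> Poly_Mapping.keys (reflect \<alpha> p)" "a = \<alpha> - b"
      using keys_reflect_subset[of \<alpha> "reflect \<alpha> p"] by blast
    have "\<alpha> - a = b"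
      using b exponents_le_reflect[of \<alpha> p]
      by (intro poly_mapping_eqI) (auto simp: exponents_le_def lookup_minus)
    with b show "\<alpha> - a \<in> Poly_Mapping.keys (reflect \<alpha> p)" by simp
  qed
qed (rule keys_reflect_subset)

lemma reflect_mult:
  assumes "exponents_le p \<alpha>" "exponents_le q \<beta>"
  shows "reflect (\<alpha> + \<beta>) (p * q) = reflect \<alpha> p * reflect \<beta> q"
proof -
  let ?c = "Poly_Mapping.lookup p" and ?d = "Poly_Mapping.lookup q"
  have "p * q = (\<Sum>a \<in> Poly_Mapping.keys p. \<Sum>b \<in> Poly_Mapping.keys q.
                   Poly_Mapping.single (a + b) (?c a * ?d b))"
    by (subst (1 2) sum_of_terms[symmetric]) (simp only: sum_product mult_single)
  then have "reflect (\<alpha> + \<beta>) (p * q) = (\<Sum>a \<in> Poly_Mapping.keys p. \<Sum>b \<in> Poly_Mapping.keys q.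
                   Poly_Mapping.single (\<alpha> + \<beta> - (a + b)) (?c a * ?d b))"
    by (simp add: reflect_sum)
  also have "\<dots> = (\<Sum>a \<in> Poly_Mapping.keys p. \<Sum>b \<in> Poly_Mapping.keys q.
                   Poly_Mapping.single ((\<alpha> - a) + (\<beta> - b)) (?c a * ?d b))"
  proof (intro sum.cong refl)
    fix a b assume "a \<in> Poly_Mapping.keys p" "b \<in> Poly_Mapping.keys q"
    then have *: "Poly_Mapping.lookup a i \<le> Poly_Mapping.lookup \<alpha> i"
        "Poly_Mapping.lookup b i \<le> Poly_Mapping.lookup \<beta> i" for i
      using assms by (auto simp: exponents_le_def)
    have "\<alpha> + \<beta> - (a + b) = (\<alpha> - a) + (\<beta> - b)"
    proof (rule poly_mapping_eqI)
      fix i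
      show "Poly_Mapping.lookup (\<alpha> + \<beta> - (a + b)) i = Poly_Mapping.lookup ((\<alpha> - a) + (\<beta> - b)) i"
        using *[of i] by (simp add: lookup_minus lookup_add)
    qed
    then show "Poly_Mapping.single (\<alpha> + \<beta> - (a + b)) (?c a * ?d b)
             = Poly_Mapping.single ((\<alpha> - a) + (\<beta> - b)) (?c a * ?d b)" by simp
  qed
  also have "\<dots> = reflect \<alpha> p * reflect \<beta> q"
    unfolding reflect_def by (simp only: sum_product mult_single)
  finally show ?thesis .
qed

text \<open>Reflecting higher than necessary only introduces a monomial factor.\<close>

lemma reflect_shift:
  assumes "exponents_le p \<alpha>"
  shows "reflect (\<alpha> + \<delta>) p = reflect \<alpha> p * Poly_Mapping.single \<delta> 1"
proof -
  have "exponents_le (1 :: 'a mpoly) \<delta>" by (auto simp: exponents_le_def)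
  moreover have "reflect \<delta> (1 :: 'a mpoly) = Poly_Mapping.single \<delta> 1"
    by (simp flip: single_one)
  ultimately show ?thesis using reflect_mult[OF assms, of 1 \<delta>] by simp
qed

lemma reflect_in_poly_ring:
  assumes "\<And>i. \<not> i \<le> n \<Longrightarrow> Poly_Mapping.lookup \<alpha> i = 0"
  shows "reflect \<alpha> p \<in> poly_ring n"
  using assms exponents_le_reflect[of \<alpha> p] unfolding exponents_le_def
  by (metis bot_nat_0.extremum_uniqueI poly_ringI)

section \<open>Maximal exponents\<close>

lemma lookup_max_exponents:
  "Poly_Mapping.lookup (max_exponents n fs) i = (if i \<le> n then max_exponent fs i else 0)"
  by (auto simp: max_exponents_def lookup_sum lookup_single when_def sum.delta)

lemma max_exponent_ge:
  assumes "f \<in> set fs" "a \<in> Poly_Mapping.keys f"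
  shows "Poly_Mapping.lookup a i \<le> max_exponent fs i"
  unfolding max_exponent_def using assms by (intro Max_ge) auto

lemma max_exponent_attained:
  assumes "f \<in> set fs" "f \<noteq> 0"
  obtains g a where "g \<in> set fs" "a \<in> Poly_Mapping.keys g" "Poly_Mapping.lookup a i = max_exponent fs i"
proof -
  have "max_exponent fs i \<in> (\<Union>f \<in> set fs. (\<lambda>a. Poly_Mapping.lookup a i) ` Poly_Mapping.keys f)"
    unfolding max_exponent_def using assms by (intro Max_in) auto
  then show thesis using that by auto
qed

lemma exponents_le_max_exponents:
  assumes "f \<in> set fs" "f \<in> poly_ring n"
  shows "exponents_le f (max_exponents n fs)"
  using assms by (auto simp: exponents_le_def lookup_max_exponents max_exponent_ge poly_ringD)

lemma newton_dual_eq_map_reflect: "newton_dual n fs = map (reflect (max_exponents n fs)) fs"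
  by (simp add: newton_dual_def reflect_def)

section \<open>Reflection and divisibility\<close>

text \<open>
  With \<open>p = h g\<close>, additivity of degrees bounds the sum of the maximal exponents of \<open>h\<close> and \<open>g\<close> by
  \<open>\<alpha>\<close>, so that \<open>\<alpha>\<close> splits into a part for \<open>h\<close>, a part for \<open>g\<close> and a monomial.
\<close>

lemma reflect_divides:
  fixes p h :: "'k::field mpoly"
  assumes "exponents_le p \<alpha>" "\<And>i. \<not> i \<le> n \<Longrightarrow> Poly_Mapping.lookup \<alpha> i = 0"
    and h: "h \<in> poly_ring n" and "divides_in n h p"
  shows "divides_in n (reflect (max_exponents n [h]) h) (reflect \<alpha> p)"
proof (cases "p = 0")
  case True
  then show ?thesis by (simp add: divides_in_zero)
next
  case False
  from \<open>divides_in n h p\<close> obtain g where g: "g \<in> poly_ring n" and p: "p = h * g"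
    by (auto simp: divides_in_def)
  let ?H = "max_exponents n [h]" and ?G = "max_exponents n [g]"
  have le: "Poly_Mapping.lookup ?H i + Poly_Mapping.lookup ?G i \<le> Poly_Mapping.lookup \<alpha> i" for i
  proof (cases "i \<le> n")
    case True
    have "h \<noteq> 0" "g \<noteq> 0" using False p by auto
    obtain a where a: "a \<in> Poly_Mapping.keys h" "Poly_Mapping.lookup a i = max_exponent [h] i"
      by (rule max_exponent_attained[of h "[h]" i]) (use \<open>h \<noteq> 0\<close> in auto)
    obtain b where b: "b \<in> Poly_Mapping.keys g" "Poly_Mapping.lookup b i = max_exponent [g] i"
      by (rule max_exponent_attained[of g "[g]" i]) (use \<open>g \<noteq> 0\<close> in auto)
    obtain c where "c \<in> Poly_Mapping.keys p"
        "Poly_Mapping.lookup a i + Poly_Mapping.lookup b i \<le> Poly_Mapping.lookup c i"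
      using keys_mult_exponent_ge[OF a(1) b(1)] p by blast
    moreover from this(1) have "Poly_Mapping.lookup c i \<le> Poly_Mapping.lookup \<alpha> i"
      using assms(1) by (simp add: exponents_le_def)
    ultimately show ?thesis using a(2) b(2) True by (simp add: lookup_max_exponents)
  qed (simp add: lookup_max_exponents)
  define \<delta> where "\<delta> = \<alpha> - (?H + ?G)"
  have split: "\<alpha> = ?H + (?G + \<delta>)"
  proof (rule poly_mapping_eqI)
    fix i
    show "Poly_Mapping.lookup \<alpha> i = Poly_Mapping.lookup (?H + (?G + \<delta>)) i"
      using le[of i] by (simp add: \<delta>_def lookup_add lookup_minus)
  qed
  have hb: "exponents_le h ?H" and gb: "exponents_le g ?G"
    using h g by (simp_all add: exponents_le_max_exponents)
  then have "exponents_le g (?G + \<delta>)" by (auto simp: exponents_le_def lookup_add trans_le_add1)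
  with hb have "reflect \<alpha> p = reflect ?H h * reflect (?G + \<delta>) g"
    unfolding split p by (rule reflect_mult)
  moreover have "reflect (?G + \<delta>) g \<in> poly_ring n"
    using assms(2)
    by (intro reflect_in_poly_ring) (simp add: \<delta>_def lookup_add lookup_minus lookup_max_exponents)
  ultimately show ?thesis by (auto simp: divides_in_def)
qed

text \<open>
  If \<open>x\<^sub>i\<close> occurs in every term, the reflection of \<open>p\<close> at its maximal exponents \<open>\<alpha>\<close> has degree below
  \<open>\<alpha>\<^sub>i\<close> in \<open>x\<^sub>i\<close>.  Reflecting it back at \<open>\<alpha>\<close> is then one step higher than necessary, which makes
  \<open>x\<^sub>i\<close> a factor of \<open>p\<close>.
\<close>

lemma variable_divides:
  fixes p :: "'k::field mpoly"
  assumes p: "p \<in> poly_ring n" and pos: "\<And>a. a \<in> Poly_Mapping.keys p \<Longrightarrow> Poly_Mapping.lookup a i > 0"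
  shows "divides_in n (Poly_Mapping.single (Poly_Mapping.single i 1) 1) p"
proof (cases "p = 0")
  case True
  then show ?thesis by (simp add: divides_in_zero)
next
  case False
  define \<alpha> where "\<alpha> = max_exponents n [p]"
  let ?e = "Poly_Mapping.single i (1::nat)"
  have b: "exponents_le p \<alpha>" using p by (simp add: \<alpha>_def exponents_le_max_exponents)
  obtain a where "a \<in> Poly_Mapping.keys p" using False by (metis keys_eq_empty equals0I)
  with pos b have "Poly_Mapping.lookup \<alpha> i > 0" by (meson exponents_le_def less_le_trans)
  then have split: "\<alpha> = (\<alpha> - ?e) + ?e"
    by (intro poly_mapping_eqI) (auto simp: lookup_add lookup_minus lookup_single when_def)
  have "exponents_le (reflect \<alpha> p) (\<alpha> - ?e)"
    using pos b by (force simp: exponents_le_def keys_reflect lookup_minus lookup_single when_def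
        intro!: diff_le_mono2)
  then have "reflect ((\<alpha> - ?e) + ?e) (reflect \<alpha> p)
      = reflect (\<alpha> - ?e) (reflect \<alpha> p) * Poly_Mapping.single ?e 1"
    by (rule reflect_shift)
  then have "p = Poly_Mapping.single ?e 1 * reflect (\<alpha> - ?e) (reflect \<alpha> p)"
    using reflect_reflect[OF b] split by (simp add: mult.commute)
  moreover have "reflect (\<alpha> - ?e) (reflect \<alpha> p) \<in> poly_ring n"
    by (rule reflect_in_poly_ring) (simp add: \<alpha>_def lookup_minus lookup_max_exponents)
  ultimately show ?thesis by (auto simp: divides_in_def)
qed

section \<open>The dual of a set of forms\<close>

text \<open>Otherwise \<open>x\<^sub>i\<close> would be a common divisor.\<close>

lemma term_free_of_variable:
  fixes fs :: "'k::field mpoly list"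
  assumes gcd: "is_gcd_in n (set fs) 1" and ring: "\<forall>f \<in> set fs. f \<in> poly_ring n" and "i \<le> n"
  obtains f a where "f \<in> set fs" "a \<in> Poly_Mapping.keys f" "Poly_Mapping.lookup a i = 0"
proof (rule ccontr)
  let ?x = "Poly_Mapping.single (Poly_Mapping.single i 1) 1 :: 'k mpoly"
  assume "\<not> thesis"
  with that have "\<forall>f \<in> set fs. divides_in n ?x f"
    using ring by (metis variable_divides gr0I)
  moreover have "?x \<in> poly_ring n"
    using \<open>i \<le> n\<close> by (intro poly_ring_single) (auto simp: lookup_single when_def)
  ultimately have "divides_in n ?x 1" using gcd by (auto simp: is_gcd_in_def)
  then have "Poly_Mapping.keys ?x = {0}"
    unfolding divides_in_def by (metis keys_factor_of_one)
  then have "Poly_Mapping.single i (1::nat) = 0" by simp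
  then show False by (metis lookup_single_eq lookup_zero one_neq_zero)
qed

text \<open>The dual of a term free of \<open>x\<^sub>i\<close> has exponent \<open>\<alpha>\<^sub>i\<close> in \<open>x\<^sub>i\<close>.\<close>

lemma max_exponents_newton_dual:
  fixes fs :: "'k::field mpoly list"
  assumes gcd: "is_gcd_in n (set fs) 1" and ring: "\<forall>f \<in> set fs. f \<in> poly_ring n"
  shows "max_exponents n (newton_dual n fs) = max_exponents n fs"
proof (rule poly_mapping_eqI)
  fix i
  let ?\<alpha> = "max_exponents n fs"
  have "max_exponent (newton_dual n fs) i = max_exponent fs i" if i: "i \<le> n"
    unfolding max_exponent_def[of "newton_dual n fs"]
  proof (rule Max_eqI)
    obtain f a where f: "f \<in> set fs" "a \<in> Poly_Mapping.keys f" "Poly_Mapping.lookup a i = 0"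
      using term_free_of_variable[OF assms i] .
    have "?\<alpha> - a \<in> Poly_Mapping.keys (reflect ?\<alpha> f)"
      using f ring by (simp add: keys_reflect exponents_le_max_exponents)
    moreover have "Poly_Mapping.lookup (?\<alpha> - a) i = max_exponent fs i"
      using f i by (simp add: lookup_minus lookup_max_exponents)
    ultimately show "max_exponent fs i \<in>
        (\<Union>f \<in> set (newton_dual n fs). (\<lambda>a. Poly_Mapping.lookup a i) ` Poly_Mapping.keys f)"
      using f(1) by (force simp: newton_dual_eq_map_reflect)
  next
    fix y
    assume "y \<in> (\<Union>f \<in> set (newton_dual n fs). (\<lambda>a. Poly_Mapping.lookup a i) ` Poly_Mapping.keys f)"
    then obtain f :: "'k mpoly" and a where "y = Poly_Mapping.lookup a i" "a \<in> Poly_Mapping.keys (reflect ?\<alpha> f)"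
      unfolding newton_dual_eq_map_reflect set_map by blast
    then show "y \<le> max_exponent fs i"
      using exponents_le_reflect[of ?\<alpha> f] i
      unfolding exponents_le_def by (metis lookup_max_exponents)
  qed auto
  then show "Poly_Mapping.lookup (max_exponents n (newton_dual n fs)) i = Poly_Mapping.lookup ?\<alpha> i"
    by (simp add: lookup_max_exponents)
qed

lemma newton_dual_newton_dual:
  fixes fs :: "'k::field mpoly list"
  assumes "is_gcd_in n (set fs) 1" and ring: "\<forall>f \<in> set fs. f \<in> poly_ring n"
  shows "newton_dual n (newton_dual n fs) = fs"
  unfolding newton_dual_eq_map_reflect[of n "newton_dual n fs"] max_exponents_newton_dual[OF assms]
  using ring
  by (auto simp: newton_dual_eq_map_reflect reflect_reflect exponents_le_max_exponents intro!: map_idI)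

lemma is_form_reflect:
  assumes f: "is_form n d f" and "exponents_le f \<alpha>" "\<And>i. \<not> i \<le> n \<Longrightarrow> Poly_Mapping.lookup \<alpha> i = 0"
  shows "is_form n ((\<Sum>i\<le>n. Poly_Mapping.lookup \<alpha> i) - d) (reflect \<alpha> f)"
  unfolding is_form_def
proof (intro conjI ballI)
  show "reflect \<alpha> f \<in> poly_ring n" using assms(3) by (rule reflect_in_poly_ring)
  fix b assume "b \<in> Poly_Mapping.keys (reflect \<alpha> f)"
  then obtain a where a: "a \<in> Poly_Mapping.keys f" and b: "b = \<alpha> - a"
    using keys_reflect_subset[of \<alpha> f] by blast
  have "(\<Sum>i\<le>n. Poly_Mapping.lookup b i)
      = (\<Sum>i\<le>n. Poly_Mapping.lookup \<alpha> i) - (\<Sum>i\<le>n. Poly_Mapping.lookup a i)"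
    unfolding b lookup_minus using assms(2) a
    by (intro sum_subtractf_nat) (auto simp: exponents_le_def)
  then show "(\<Sum>i\<le>n. Poly_Mapping.lookup b i) = (\<Sum>i\<le>n. Poly_Mapping.lookup \<alpha> i) - d"
    using f a by (simp add: is_form_def)
qed

text \<open>
  The reflection of a common divisor \<open>h\<close> of the dual is a common divisor of \<open>fs\<close>, so it is constant
  and \<open>h\<close> has a single term; the dual of a term of \<open>fs\<close> of maximal exponent in \<open>x\<^sub>i\<close> shows that
  \<open>x\<^sub>i\<close> does not occur in it.
\<close>

lemma is_gcd_in_newton_dual:
  fixes fs :: "'k::field mpoly list"
  assumes gcd: "is_gcd_in n (set fs) 1" and ring: "\<forall>f \<in> set fs. f \<in> poly_ring n"
    and nz: "\<exists>f \<in> set fs. f \<noteq> 0"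
  shows "is_gcd_in n (set (newton_dual n fs)) 1"
  unfolding is_gcd_in_def
proof (intro conjI ballI impI)
  let ?\<alpha> = "max_exponents n fs"
  have \<alpha>0: "\<not> i \<le> n \<Longrightarrow> Poly_Mapping.lookup ?\<alpha> i = 0" for i
    by (simp add: lookup_max_exponents)
  show "(1 :: 'k mpoly) \<in> poly_ring n" using gcd by (simp add: is_gcd_in_def)
  show "divides_in n 1 p" if "p \<in> set (newton_dual n fs)" for p
    using that \<alpha>0 by (auto simp: divides_in_def newton_dual_eq_map_reflect reflect_in_poly_ring)
  fix h assume h: "h \<in> poly_ring n" and div: "\<forall>p \<in> set (newton_dual n fs). divides_in n h p"
  let ?H = "max_exponents n [h]"
  have H0: "\<not> i \<le> n \<Longrightarrow> Poly_Mapping.lookup ?H i = 0" for i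
    by (simp add: lookup_max_exponents)
  have hb: "exponents_le h ?H" using h by (simp add: exponents_le_max_exponents)
  have "divides_in n (reflect ?H h) f" if f: "f \<in> set fs" for f
  proof -
    have "divides_in n h (reflect ?\<alpha> f)" using div f by (auto simp: newton_dual_eq_map_reflect)
    then have "divides_in n (reflect ?H h) (reflect ?\<alpha> (reflect ?\<alpha> f))"
      using h \<alpha>0 by (intro reflect_divides exponents_le_reflect)
    then show ?thesis using f ring by (simp add: reflect_reflect exponents_le_max_exponents)
  qed
  moreover have "reflect ?H h \<in> poly_ring n" using H0 by (rule reflect_in_poly_ring)
  ultimately have "divides_in n (reflect ?H h) 1" using gcd by (auto simp: is_gcd_in_def)
  then obtain u where u: "u \<in> poly_ring n" "reflect ?H h * u = 1" by (auto simp: divides_in_def)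
  then have keys: "Poly_Mapping.keys (reflect ?H h) = {0}" by (intro keys_factor_of_one)
  then have "reflect ?H h = Poly_Mapping.single 0 (Poly_Mapping.lookup (reflect ?H h) 0)"
    using sum_of_terms[of "reflect ?H h"] by simp
  then have h_eq: "h = Poly_Mapping.single ?H (Poly_Mapping.lookup (reflect ?H h) 0)"
    by (metis reflect_reflect[OF hb] reflect_single diff_zero)
  have "?H = 0"
  proof (rule poly_mapping_eqI)
    fix i
    obtain f a where f: "f \<in> set fs" "a \<in> Poly_Mapping.keys f" "Poly_Mapping.lookup a i = max_exponent fs i"
      using nz by (metis max_exponent_attained)
    have mem: "?\<alpha> - a \<in> Poly_Mapping.keys (reflect ?\<alpha> f)"
      using f ring by (simp add: keys_reflect exponents_le_max_exponents)
    obtain g where "reflect ?\<alpha> f = h * g"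
      using div f(1) by (auto simp: newton_dual_eq_map_reflect divides_in_def)
    with mem obtain x y where "x \<in> Poly_Mapping.keys h" "?\<alpha> - a = x + y"
      using keys_mult[of h g] by auto
    moreover from this(1) have "x = ?H" using h_eq by (metis keys_single empty_iff singletonD)
    ultimately have "Poly_Mapping.lookup ?H i \<le> Poly_Mapping.lookup (?\<alpha> - a) i"
      by (simp add: lookup_add)
    then show "Poly_Mapping.lookup ?H i = Poly_Mapping.lookup 0 i"
      using f(3) by (simp add: lookup_minus lookup_max_exponents split: if_splits)
  qed
  then have "reflect ?H h = h" using h_eq reflect_single[of 0 0] by (metis diff_zero)
  with \<open>divides_in n (reflect ?H h) 1\<close> show "divides_in n h 1" by simp
qed

theorem lemma1p4:
  fixes n m d :: nat
    and fs :: "'k::field mpoly list"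
  assumes "infinite (UNIV :: 'k set)"
    and "d \<ge> 1"
    and "length fs = m + 1"
    and "\<forall>f \<in> set fs. is_form n d f"
    and "canonical_restrictions n fs"
  shows "canonical_restrictions n (newton_dual n fs) \<and> newton_dual n (newton_dual n fs) = fs"
proof -
  let ?\<alpha> = "max_exponents n fs"
  have ring: "\<forall>f \<in> set fs. f \<in> poly_ring n" using assms(4) by (simp add: is_form_def)
  have gcd: "is_gcd_in n (set fs) 1" and nz: "\<exists>f \<in> set fs. f \<noteq> 0"
    and app: "\<forall>i\<le>n. \<exists>f \<in> set fs. appears_in i f"
    using assms(5) by (auto simp: canonical_restrictions_def)
  have bound: "exponents_le f ?\<alpha>" if "f \<in> set fs" for f
    using that ring by (simp add: exponents_le_max_exponents)
  have dd: "newton_dual n (newton_dual n fs) = fs"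
    using gcd ring by (rule newton_dual_newton_dual)
  have "is_form n ((\<Sum>i\<le>n. Poly_Mapping.lookup ?\<alpha> i) - d) (reflect ?\<alpha> f)" if "f \<in> set fs" for f
    using assms(4) bound that by (intro is_form_reflect) (simp_all add: lookup_max_exponents)
  then have "\<exists>e. \<forall>f \<in> set (newton_dual n fs). is_form n e f"
    by (auto simp: newton_dual_eq_map_reflect)
  moreover have "\<exists>f \<in> set (newton_dual n fs). f \<noteq> 0"
    using nz bound unfolding newton_dual_eq_map_reflect set_map
    by (metis imageI reflect_reflect reflect_0)
  moreover have "is_gcd_in n (set (newton_dual n fs)) 1"
    using gcd ring nz by (rule is_gcd_in_newton_dual)
  moreover have "\<exists>f \<in> set (newton_dual n fs). appears_in i f" if i: "i \<le> n" for i
  proof -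
    have "max_exponent fs i > 0"
      using app i max_exponent_ge unfolding appears_in_def by (metis less_le_trans)
    moreover obtain f a where f: "f \<in> set fs" "a \<in> Poly_Mapping.keys f" "Poly_Mapping.lookup a i = 0"
      using term_free_of_variable[OF gcd ring i] .
    ultimately have "Poly_Mapping.lookup (?\<alpha> - a) i > 0"
      using i by (simp add: lookup_minus lookup_max_exponents)
    moreover have "?\<alpha> - a \<in> Poly_Mapping.keys (reflect ?\<alpha> f)"
      using f bound by (simp add: keys_reflect)
    ultimately show ?thesis
      using f(1) by (auto simp: appears_in_def newton_dual_eq_map_reflect)
  qed
  ultimately show ?thesis using dd by (auto simp: canonical_restrictions_def)
qed

end
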